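(* Let $\phi$ be a safe-PCTL formula with finite horizon (as defined in the context). Let $\mathcal{P}$ be a finite POMDP, let $\mathcal{M}^z_1$ be its corresponding $0/1$-WA$^z$, and let $\mathcal{M}^z_2$ be a $0/1$-WA$^z$ with $\mathcal{M}^z_1\preceq\mathcal{M}^z_2$ (i.e. $\mathcal{M}^z_2$ safely simulates $\mathcal{M}^z_1$). If $\mathcal{M}^z_2\models\phi$, then $\mathcal{P}\models\phi$.
   Context: A POMDP is $\mathcal{P}=\{S,\bar{s},A,Z,T,O\}$ with finite state set $S$, initial state $\bar{s}$, finite action set $A$, finite observation set $Z$, transition function $T:S\times A\times S\to[0,1]$ with $\sum_{s'}T(s,a,s')=1$, observation function $O:S\times Z\to[0,1]$ with $\sum_z O(s,z)=1$, and an atomic-proposition labeling $L:S\to 2^{AP}$. A $0/1$-WA$^z$ is a tuple $\{S,\bar{s},A,T,Z,L,L^z\}$ as a POMDP-like structure but with $T:S\times A\times S\to[0,1]$ not required to sum to $1$, $L:S\to2^{AP}$, and a z-labeling $L^z:S\to Z$ giving each state a single observation. The corresponding $0/1$-WA$^z$ of $\mathcal{P}$ has states $\{[s,z]:s\in S,z\in Z\}\cup\{\bar{s}\}$, initial state $\bar{s}$, actions $A$, transitions $T^+(x,a,[s',z'])=T(s,a,s')\,O(s',z')$ where $x=\bar{s}$ (with $s=\bar{s}$) or $x=[s,z]$, observation labels $Z\cup\{init\}$ with $L^z(\bar{s})=init$, $L^z([s,z])=z$, and proposition labels inherited from the $S$-component. Paths are sequences $s_0a_0s_1a_1\dots$ starting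 at the initial state; the weight of a finite path is $\prod_i T(s_i,a_i,s_{i+1})$. An adversary maps finite paths to actions; it is observation-based if it gives the same action to any two finite paths with the same observation sequence (in a POMDP, the sequence of observations $z_i$ emitted with $O(s_i,z_i)>0$ and actions; in a $0/1$-WA$^z$, the sequence of labels $L^z(s_i)$ and actions). Under an adversary, the (weighted) probability of a set of paths is the measure induced by path weights. Satisfaction: $s\models true$; $s\models\alpha$ iff $\alpha\in L(s)$; $\wedge,\vee,\neg$ as usual; $s\models P_{\unlhd p}[\psi]$ iff for every observation-based adversary the (weighted) probability of paths from $s$ satisfying $\psi$ is $\unlhd p$; a path $\rho$ satisfies $\phi_1\,\mathcal{U}^{\leq k}\phi_2$ iff there is $i\leq k$ with $\rho(i)\models\phi_2$ and $\rho(j)\models\phi_1$ for all $j<i$. A system satisfies $\phi$ iff its initial state does. Finite-horizon safe-PCTL formulas are generated by $\phi_S::=true\mid\alpha\mid\phi_S\wedge\phi_S\mid\phi_S\vee\phi_S\mid P_{\unlhd p}[\phi_L\,\mathcal{U}^{\leq k}\phi_L]$, $\phi_L::=true\mid\alpha\mid\phi_L\wedge\phi_L\mid\phi_L\vee\phi_L\mid\neg P_{\unlhd p}[\phi_L\,\mathcal{U}^{\leq k}\phi_L]$ with $\alpha\in AP$, $\unlhd\in\{\leq,<\}$, $p\in[0,1]$, $k\in\mathbb{N}$. Safe simulation: for $0/1$-WA$^z$ $\mathcal{M}^z_1,\mathcal{M}^z_2$ over the same $A$ and $Z$, write $s_i\xrightarrow{a}\mu_i$ with $\mu_i(s')=T_i(s_i,a,s')$.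 For $R\subseteq S_1\times S_2$, $\mu_1\sqsubseteq_R\mu_2$ means there is $w:S_1\times S_2\to[0,1]$ with $\mu_1(s_1)=\sum_{s_2}w(s_1,s_2)$ for all $s_1$, $\mu_2(s_2)\geq\sum_{s_1}w(s_1,s_2)$ for all $s_2$, $w(s_1,s_2)=0$ if $L^z_1(s_1)\neq L^z_2(s_2)$ or $L_1(s_1)\neq L_2(s_2)$, and $w(s_1,s_2)>0\Rightarrow s_1Rs_2$. $R$ is a safe simulation if for every $s_1Rs_2$ and $s_1\xrightarrow{a}\mu_1$ there is $s_2\xrightarrow{a}\mu_2$ with $\mu_1\sqsubseteq_R\mu_2$. $\mathcal{M}^z_1\preceq\mathcal{M}^z_2$ iff some safe simulation relates $\bar{s}_1$ and $\bar{s}_2$.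
   Formalization: The formal statement additionally assumes that the initial states of M1^z and M2^z carry the same atomic propositions; safe simulation as defined compares labels only of successor states, and without this the claim fails already for φ = α. *)

theory Defs
  imports Complex_Main
begin

section \<open>POMDPs and 0/1-weighted automata with observation labels\<close>

text \<open>Finite state, action and observation sets are rendered by types of class
  \<open>finite\<close>, so that two systems over the same actions and observations share the
  corresponding type arguments.\<close>

record ('s, 'a, 'z, 'ap) pomdp =
  pomdp_init :: 's
  pomdp_trans :: "'s \<Rightarrow> 'a \<Rightarrow> 's \<Rightarrow> real"
  pomdp_obs :: "'s \<Rightarrow> 'z \<Rightarrow> real"
  pomdp_label :: "'s \<Rightarrow> 'ap set"

definition is_pomdp :: "('s::finite, 'a::finite, 'z::finite, 'ap) pomdp \<Rightarrow> bool" where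
  "is_pomdp P \<longleftrightarrow>
     (\<forall>s a s'. pomdp_trans P s a s' \<in> {0..1}) \<and>
     (\<forall>s a. (\<Sum>s'\<in>UNIV. pomdp_trans P s a s') = 1) \<and>
     (\<forall>s z. pomdp_obs P s z \<in> {0..1}) \<and>
     (\<forall>s. (\<Sum>z\<in>UNIV. pomdp_obs P s z) = 1)"

record ('s, 'a, 'z, 'ap) wa =
  wa_init :: 's
  wa_trans :: "'s \<Rightarrow> 'a \<Rightarrow> 's \<Rightarrow> real"
  wa_label :: "'s \<Rightarrow> 'ap set"
  wa_zlabel :: "'s \<Rightarrow> 'z"

definition is_wa :: "('s::finite, 'a::finite, 'z::finite, 'ap) wa \<Rightarrow> bool" where
  "is_wa M \<longleftrightarrow> (\<forall>s a s'. wa_trans M s a s' \<in> {0..1})"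

text \<open>In the automaton of a POMDP, the state \<open>None\<close> is the initial state, the state
  \<open>Some (s, z)\<close> is [s,z], and the observation label \<open>None\<close> is the extra label init.\<close>

definition split_state :: "('s, 'a, 'z, 'ap) pomdp \<Rightarrow> ('s \<times> 'z) option \<Rightarrow> 's" where
  "split_state P x = (case x of None \<Rightarrow> pomdp_init P | Some (s, z) \<Rightarrow> s)"

definition corresponding_wa ::
    "('s, 'a, 'z, 'ap) pomdp \<Rightarrow> (('s \<times> 'z) option, 'a, 'z option, 'ap) wa" where
  "corresponding_wa P = \<lparr>
     wa_init = None,
     wa_trans = (\<lambda>x a y. case y of None \<Rightarrow> 0
                   | Some (s', z') \<Rightarrow> pomdp_trans P (split_state P x) a s' * pomdp_obs P s' z'),
     wa_label = (\<lambda>x. pomdp_label P (split_state P x)),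
     wa_zlabel = (\<lambda>x. case x of None \<Rightarrow> None | Some (s, z) \<Rightarrow> Some z) \<rparr>"

section \<open>Finite paths\<close>

text \<open>The finite path s0 a0 s1 a1 s2 ... is encoded as \<open>(s0, [(a0, s1), (a1, s2), \<dots>])\<close>.\<close>

type_synonym ('s, 'a) fpath = "'s \<times> ('a \<times> 's) list"

definition path_states :: "('s, 'a) fpath \<Rightarrow> 's list" where
  "path_states \<rho> = fst \<rho> # map snd (snd \<rho>)"

definition path_actions :: "('s, 'a) fpath \<Rightarrow> 'a list" where
  "path_actions \<rho> = map fst (snd \<rho>)"

definition path_len :: "('s, 'a) fpath \<Rightarrow> nat" where
  "path_len \<rho> = length (snd \<rho>)"

definition path_take :: "nat \<Rightarrow> ('s, 'a) fpath \<Rightarrow> ('s, 'a) fpath" where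
  "path_take n \<rho> = (fst \<rho>, take n (snd \<rho>))"

definition path_weight :: "('s \<Rightarrow> 'a \<Rightarrow> 's \<Rightarrow> real) \<Rightarrow> ('s, 'a) fpath \<Rightarrow> real" where
  "path_weight T \<rho> =
     (\<Prod>i<path_len \<rho>. T (path_states \<rho> ! i) (path_actions \<rho> ! i) (path_states \<rho> ! Suc i))"

text \<open>A finite path satisfies the bounded until formula if the witnessing index lies on it.
  The infinite paths satisfying the formula are the disjoint union of the cylinders of the
  finite paths in \<open>until_paths\<close> (those that satisfy it while no proper prefix does), and the
  probability of the formula is the sum of the weights of these cylinders. For transition
  functions that do not sum to 1 the weight of a cylinder need not be the sum of the weights
  of its subcylinders, so the choice of the minimal prefixes matters.\<close>

definition sat_until ::
    "('s \<Rightarrow> bool) \<Rightarrow> nat \<Rightarrow> ('s \<Rightarrow> bool) \<Rightarrow> ('s, 'a) fpath \<Rightarrow> bool" where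
  "sat_until \<Phi>1 k \<Phi>2 \<rho> \<longleftrightarrow>
     (\<exists>i\<le>k. i \<le> path_len \<rho> \<and> \<Phi>2 (path_states \<rho> ! i) \<and> (\<forall>j<i. \<Phi>1 (path_states \<rho> ! j)))"

definition until_paths ::
    "'s \<Rightarrow> ('s \<Rightarrow> bool) \<Rightarrow> nat \<Rightarrow> ('s \<Rightarrow> bool) \<Rightarrow> ('s, 'a) fpath set" where
  "until_paths s \<Phi>1 k \<Phi>2 =
     {\<rho>. fst \<rho> = s \<and> sat_until \<Phi>1 k \<Phi>2 \<rho> \<and>
         (\<forall>n<path_len \<rho>. \<not> sat_until \<Phi>1 k \<Phi>2 (path_take n \<rho>))}"

lemma until_paths_len:
  assumes "\<rho> \<in> until_paths s \<Phi>1 k \<Phi>2"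
  shows "path_len \<rho> \<le> k"
proof (rule ccontr)
  assume less: "\<not> path_len \<rho> \<le> k"
  from assms obtain i where i: "i \<le> k" "\<Phi>2 (path_states \<rho> ! i)"
      "\<forall>j<i. \<Phi>1 (path_states \<rho> ! j)"
    by (auto simp: until_paths_def sat_until_def)
  have "path_states (path_take k \<rho>) ! j = path_states \<rho> ! j" if "j \<le> k" for j
    using that less by (cases j) (auto simp: path_states_def path_take_def path_len_def)
  with i less have "sat_until \<Phi>1 k \<Phi>2 (path_take k \<rho>)"
    by (auto simp: sat_until_def path_take_def path_len_def intro!: exI[of _ i])
  with assms less show False by (auto simp: until_paths_def)
qed

lemma finite_until_paths:
  "finite (until_paths s \<Phi>1 k \<Phi>2 :: ('s::finite, 'a::finite) fpath set)"
proof (rule finite_subset)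
  show "(until_paths s \<Phi>1 k \<Phi>2 :: ('s, 'a) fpath set) \<subseteq>
      {s} \<times> {xs. set xs \<subseteq> UNIV \<and> length xs \<le> k}"
    using until_paths_len[of _ s \<Phi>1 k \<Phi>2]
    by (fastforce simp: path_len_def until_paths_def)
  show "finite ({s} \<times> {xs :: ('a \<times> 's) list. set xs \<subseteq> UNIV \<and> length xs \<le> k})"
    by (intro finite_cartesian_product finite_lists_length_le) auto
qed

section \<open>Observation-based adversaries and probabilities\<close>

definition wa_obs_based :: "('s, 'a, 'z, 'ap) wa \<Rightarrow> (('s, 'a) fpath \<Rightarrow> 'a) \<Rightarrow> bool" where
  "wa_obs_based M \<sigma> \<longleftrightarrow>
     (\<forall>\<rho> \<rho>'. map (wa_zlabel M) (path_states \<rho>) = map (wa_zlabel M) (path_states \<rho>') \<and>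
        path_actions \<rho> = path_actions \<rho>' \<longrightarrow> \<sigma> \<rho> = \<sigma> \<rho>')"

definition wa_follows :: "(('s, 'a) fpath \<Rightarrow> 'a) \<Rightarrow> ('s, 'a) fpath \<Rightarrow> bool" where
  "wa_follows \<sigma> \<rho> \<longleftrightarrow> (\<forall>i<path_len \<rho>. path_actions \<rho> ! i = \<sigma> (path_take i \<rho>))"

definition wa_prob_until ::
    "('s, 'a, 'z, 'ap) wa \<Rightarrow> (('s, 'a) fpath \<Rightarrow> 'a) \<Rightarrow> 's \<Rightarrow>
     ('s \<Rightarrow> bool) \<Rightarrow> nat \<Rightarrow> ('s \<Rightarrow> bool) \<Rightarrow> real" where
  "wa_prob_until M \<sigma> s \<Phi>1 k \<Phi>2 =
     (\<Sum>\<rho> | \<rho> \<in> until_paths s \<Phi>1 k \<Phi>2 \<and> wa_follows \<sigma> \<rho>. path_weight (wa_trans M) \<rho>)"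

text \<open>In a POMDP a finite path does not determine its observation sequence: each visited
  state \<open>s\<close>, the first one included, emits \<open>z\<close> with probability \<open>O(s, z)\<close>. An adversary
  therefore reads a finite path together with the observations emitted along it, and being
  observation-based means that only these observations and the actions count. The
  probability of a path is then its weight times the probabilities of the emissions, summed
  over the emissions. If \<open>O\<close> is deterministic, this is the plain path weight.\<close>

definition emits :: "('s, 'a, 'z, 'ap) pomdp \<Rightarrow> ('s, 'a) fpath \<Rightarrow> 'z list \<Rightarrow> bool" where
  "emits P \<rho> zs \<longleftrightarrow> list_all2 (\<lambda>s z. pomdp_obs P s z > 0) (path_states \<rho>) zs"

definition pomdp_obs_based ::
    "('s, 'a, 'z, 'ap) pomdp \<Rightarrow> (('s, 'a) fpath \<Rightarrow> 'z list \<Rightarrow> 'a) \<Rightarrow> bool" where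
  "pomdp_obs_based P \<sigma> \<longleftrightarrow>
     (\<forall>\<rho> \<rho>' zs. emits P \<rho> zs \<and> emits P \<rho>' zs \<and> path_actions \<rho> = path_actions \<rho>' \<longrightarrow>
        \<sigma> \<rho> zs = \<sigma> \<rho>' zs)"

definition pomdp_follows ::
    "(('s, 'a) fpath \<Rightarrow> 'z list \<Rightarrow> 'a) \<Rightarrow> ('s, 'a) fpath \<Rightarrow> 'z list \<Rightarrow> bool" where
  "pomdp_follows \<sigma> \<rho> zs \<longleftrightarrow>
     (\<forall>i<path_len \<rho>. path_actions \<rho> ! i = \<sigma> (path_take i \<rho>) (take (Suc i) zs))"

definition emission_prob ::
    "('s, 'a, 'z, 'ap) pomdp \<Rightarrow> ('s, 'a) fpath \<Rightarrow> 'z list \<Rightarrow> real" where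
  "emission_prob P \<rho> zs = (\<Prod>i\<le>path_len \<rho>. pomdp_obs P (path_states \<rho> ! i) (zs ! i))"

definition pomdp_prob_until ::
    "('s, 'a, 'z, 'ap) pomdp \<Rightarrow> (('s, 'a) fpath \<Rightarrow> 'z list \<Rightarrow> 'a) \<Rightarrow> 's \<Rightarrow>
     ('s \<Rightarrow> bool) \<Rightarrow> nat \<Rightarrow> ('s \<Rightarrow> bool) \<Rightarrow> real" where
  "pomdp_prob_until P \<sigma> s \<Phi>1 k \<Phi>2 =
     (\<Sum>\<rho>\<in>until_paths s \<Phi>1 k \<Phi>2.
        \<Sum>zs | emits P \<rho> zs \<and> pomdp_follows \<sigma> \<rho> zs.
          path_weight (pomdp_trans P) \<rho> * emission_prob P \<rho> zs)"

lemma finite_emits: "finite {zs :: 'z::finite list. emits P \<rho> zs}"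
proof (rule finite_subset)
  show "{zs :: 'z list. emits P \<rho> zs} \<subseteq> {zs. set zs \<subseteq> UNIV \<and> length zs = length (path_states \<rho>)}"
    by (auto simp: emits_def dest: list_all2_lengthD)
  show "finite {zs :: 'z list. set zs \<subseteq> UNIV \<and> length zs = length (path_states \<rho>)}"
    by (rule finite_lists_length_eq) simp
qed

section \<open>Safe-PCTL with finite horizon\<close>

datatype bound = AtMost | LessThan

primrec in_bound :: "bound \<Rightarrow> real \<Rightarrow> real \<Rightarrow> bool" where
  "in_bound AtMost x p \<longleftrightarrow> x \<le> p"
| "in_bound LessThan x p \<longleftrightarrow> x < p"

datatype 'ap pctl =
    PTrue
  | Atom 'ap
  | And "'ap pctl" "'ap pctl"
  | Or "'ap pctl" "'ap pctl"
  | Neg "'ap pctl"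
  | PUntil bound real "'ap pctl" nat "'ap pctl"

text \<open>\<open>PUntil b p \<phi>1 k \<phi>2\<close> is the formula P with bound \<open>b p\<close> of \<open>\<phi>1\<close> U-at-most-\<open>k\<close> \<open>\<phi>2\<close>;
  \<open>safe_S\<close> and \<open>safe_L\<close> are the two nonterminals of the grammar of safe formulas.\<close>

inductive safe_L :: "'ap pctl \<Rightarrow> bool" where
  "safe_L PTrue"
| "safe_L (Atom \<alpha>)"
| "safe_L \<phi>1 \<Longrightarrow> safe_L \<phi>2 \<Longrightarrow> safe_L (And \<phi>1 \<phi>2)"
| "safe_L \<phi>1 \<Longrightarrow> safe_L \<phi>2 \<Longrightarrow> safe_L (Or \<phi>1 \<phi>2)"
| "safe_L \<phi>1 \<Longrightarrow> safe_L \<phi>2 \<Longrightarrow> p \<in> {0..1} \<Longrightarrow> safe_L (Neg (PUntil b p \<phi>1 k \<phi>2))"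

inductive safe_S :: "'ap pctl \<Rightarrow> bool" where
  "safe_S PTrue"
| "safe_S (Atom \<alpha>)"
| "safe_S \<phi>1 \<Longrightarrow> safe_S \<phi>2 \<Longrightarrow> safe_S (And \<phi>1 \<phi>2)"
| "safe_S \<phi>1 \<Longrightarrow> safe_S \<phi>2 \<Longrightarrow> safe_S (Or \<phi>1 \<phi>2)"
| "safe_L \<phi>1 \<Longrightarrow> safe_L \<phi>2 \<Longrightarrow> p \<in> {0..1} \<Longrightarrow> safe_S (PUntil b p \<phi>1 k \<phi>2)"

primrec wa_sat :: "('s, 'a, 'z, 'ap) wa \<Rightarrow> 'ap pctl \<Rightarrow> 's \<Rightarrow> bool" where
  "wa_sat M PTrue = (\<lambda>s. True)"
| "wa_sat M (Atom \<alpha>) = (\<lambda>s. \<alpha> \<in> wa_label M s)"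
| "wa_sat M (And \<phi>1 \<phi>2) = (\<lambda>s. wa_sat M \<phi>1 s \<and> wa_sat M \<phi>2 s)"
| "wa_sat M (Or \<phi>1 \<phi>2) = (\<lambda>s. wa_sat M \<phi>1 s \<or> wa_sat M \<phi>2 s)"
| "wa_sat M (Neg \<phi>) = (\<lambda>s. \<not> wa_sat M \<phi> s)"
| "wa_sat M (PUntil b p \<phi>1 k \<phi>2) = (\<lambda>s. \<forall>\<sigma>. wa_obs_based M \<sigma> \<longrightarrow>
     in_bound b (wa_prob_until M \<sigma> s (wa_sat M \<phi>1) k (wa_sat M \<phi>2)) p)"

primrec pomdp_sat :: "('s, 'a, 'z, 'ap) pomdp \<Rightarrow> 'ap pctl \<Rightarrow> 's \<Rightarrow> bool" where
  "pomdp_sat P PTrue = (\<lambda>s. True)"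
| "pomdp_sat P (Atom \<alpha>) = (\<lambda>s. \<alpha> \<in> pomdp_label P s)"
| "pomdp_sat P (And \<phi>1 \<phi>2) = (\<lambda>s. pomdp_sat P \<phi>1 s \<and> pomdp_sat P \<phi>2 s)"
| "pomdp_sat P (Or \<phi>1 \<phi>2) = (\<lambda>s. pomdp_sat P \<phi>1 s \<or> pomdp_sat P \<phi>2 s)"
| "pomdp_sat P (Neg \<phi>) = (\<lambda>s. \<not> pomdp_sat P \<phi> s)"
| "pomdp_sat P (PUntil b p \<phi>1 k \<phi>2) = (\<lambda>s. \<forall>\<sigma>. pomdp_obs_based P \<sigma> \<longrightarrow>
     in_bound b (pomdp_prob_until P \<sigma> s (pomdp_sat P \<phi>1) k (pomdp_sat P \<phi>2)) p)"

definition wa_models :: "('s, 'a, 'z, 'ap) wa \<Rightarrow> 'ap pctl \<Rightarrow> bool" where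
  "wa_models M \<phi> \<longleftrightarrow> wa_sat M \<phi> (wa_init M)"

definition pomdp_models :: "('s, 'a, 'z, 'ap) pomdp \<Rightarrow> 'ap pctl \<Rightarrow> bool" where
  "pomdp_models P \<phi> \<longleftrightarrow> pomdp_sat P \<phi> (pomdp_init P)"

section \<open>Safe simulation\<close>

definition wa_step :: "('s, 'a, 'z, 'ap) wa \<Rightarrow> 's \<Rightarrow> 'a \<Rightarrow> ('s \<Rightarrow> real) \<Rightarrow> bool" where
  "wa_step M s a \<mu> \<longleftrightarrow> (\<forall>s'. \<mu> s' = wa_trans M s a s')"

definition dominated ::
    "('s::finite, 'a, 'z, 'ap) wa \<Rightarrow> ('t::finite, 'a, 'z, 'ap) wa \<Rightarrow> ('s \<times> 't) set \<Rightarrow>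
     ('s \<Rightarrow> real) \<Rightarrow> ('t \<Rightarrow> real) \<Rightarrow> bool" where
  "dominated M1 M2 R \<mu>1 \<mu>2 \<longleftrightarrow> (\<exists>w :: 's \<Rightarrow> 't \<Rightarrow> real.
     (\<forall>s1 s2. w s1 s2 \<in> {0..1}) \<and>
     (\<forall>s1. \<mu>1 s1 = (\<Sum>s2\<in>UNIV. w s1 s2)) \<and>
     (\<forall>s2. \<mu>2 s2 \<ge> (\<Sum>s1\<in>UNIV. w s1 s2)) \<and>
     (\<forall>s1 s2. wa_zlabel M1 s1 \<noteq> wa_zlabel M2 s2 \<or> wa_label M1 s1 \<noteq> wa_label M2 s2
        \<longrightarrow> w s1 s2 = 0) \<and>
     (\<forall>s1 s2. w s1 s2 > 0 \<longrightarrow> (s1, s2) \<in> R))"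

definition safe_simulation ::
    "('s::finite, 'a, 'z, 'ap) wa \<Rightarrow> ('t::finite, 'a, 'z, 'ap) wa \<Rightarrow> ('s \<times> 't) set \<Rightarrow> bool" where
  "safe_simulation M1 M2 R \<longleftrightarrow>
     (\<forall>(s1, s2)\<in>R. \<forall>a \<mu>1. wa_step M1 s1 a \<mu>1 \<longrightarrow>
        (\<exists>\<mu>2. wa_step M2 s2 a \<mu>2 \<and> dominated M1 M2 R \<mu>1 \<mu>2))"

definition safely_simulated ::
    "('s::finite, 'a, 'z, 'ap) wa \<Rightarrow> ('t::finite, 'a, 'z, 'ap) wa \<Rightarrow> bool" where
  "safely_simulated M1 M2 \<longleftrightarrow>
     (\<exists>R. safe_simulation M1 M2 R \<and> (wa_init M1, wa_init M2) \<in> R)"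

end

theory Submission imports Defs begin

text \<open>Once the first emission \<open>z\<close> of a state is fixed, an observation-based adversary of the
  POMDP reads only later observations and actions, so it also acts on the corresponding
  automaton and on every automaton simulating it. The POMDP probability is the
  \<open>O(s, z)\<close>-weighted average of the automaton probabilities obtained in this way, hence some
  \<open>z\<close> does at least as well as the average. Along the simulation these probabilities can only
  grow, by induction on the step bound: if the simulating state already satisfies the target
  formula its value is 1, which dominates because the automaton of a POMDP is stochastic;
  otherwise one compares successors through the weight function \<open>w\<close>.\<close>

section \<open>First-step decomposition of paths\<close>

lemma path_states_Cons [simp]:
  "path_states (s, (a, s') # xs) = s # path_states (s', xs)"
  by (simp add: path_states_def)

lemma path_states_Nil [simp]: "path_states (s, []) = [s]"
  by (simp add: path_states_def)

lemma path_actions_Cons [simp]: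
  "path_actions (s, (a, s') # xs) = a # path_actions (s', xs)"
  by (simp add: path_actions_def)

lemma path_actions_Nil [simp]: "path_actions (s, []) = []"
  by (simp add: path_actions_def)

lemma path_len_Cons [simp]: "path_len (s, (a, s') # xs) = Suc (path_len (s', xs))"
  by (simp add: path_len_def)

lemma path_len_Nil [simp]: "path_len (s, []) = 0"
  by (simp add: path_len_def)

lemma path_take_0 [simp]: "path_take 0 \<rho> = (fst \<rho>, [])"
  by (simp add: path_take_def)

lemma path_take_Suc [simp]:
  "path_take (Suc n) (s, (a, s') # xs) = (s, (a, s') # snd (path_take n (s', xs)))"
  by (simp add: path_take_def)

lemma path_weight_Nil [simp]: "path_weight T (s, []) = 1"
  by (simp add: path_weight_def)

lemma path_states_nth_0 [simp]: "path_states (s, xs) ! 0 = s"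
  by (simp add: path_states_def)

lemma path_weight_Cons [simp]:
  "path_weight T (s, (a, s') # xs) = T s a s' * path_weight T (s', xs)"
  by (simp add: path_weight_def prod.lessThan_Suc_shift del: prod.lessThan_Suc)

lemma all_less_Suc_shift: "(\<forall>i<Suc n. Q i) \<longleftrightarrow> Q 0 \<and> (\<forall>i<n. Q (Suc i))"
  by (auto simp: less_Suc_eq_0_disj)

lemma wa_follows_Nil [simp]: "wa_follows \<sigma> (s, [])"
  by (simp add: wa_follows_def)

text \<open>The tail follows the residual adversary, which puts the first step in front of every
  prefix it reads.\<close>

lemma wa_follows_Cons:
  "wa_follows \<sigma> (s, (a, s') # xs) \<longleftrightarrow>
     a = \<sigma> (s, []) \<and> wa_follows (\<lambda>\<rho>. \<sigma> (s, (a, fst \<rho>) # snd \<rho>)) (s', xs)"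
  by (simp add: wa_follows_def all_less_Suc_shift) (simp add: path_take_def)

section \<open>Bounded until and its minimal paths under one step\<close>

lemma sat_until_start: "\<Phi>2 s \<Longrightarrow> sat_until \<Phi>1 k \<Phi>2 (s, xs)"
  by (auto simp: sat_until_def intro!: exI[of _ 0])

lemma sat_until_Nil: "sat_until \<Phi>1 k \<Phi>2 (s, []) \<longleftrightarrow> \<Phi>2 s"
  by (auto simp: sat_until_def)

lemma sat_until_0: "sat_until \<Phi>1 0 \<Phi>2 (s, xs) \<longleftrightarrow> \<Phi>2 s"
  by (auto simp: sat_until_def)

lemma sat_until_Cons:
  "sat_until \<Phi>1 (Suc k) \<Phi>2 (s, (a, s') # xs) \<longleftrightarrow>
     \<Phi>2 s \<or> \<Phi>1 s \<and> sat_until \<Phi>1 k \<Phi>2 (s', xs)"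
  (is "?L \<longleftrightarrow> ?R")
proof
  assume ?L
  then obtain i where i: "i \<le> Suc k" "i \<le> Suc (path_len (s', xs))"
      "\<Phi>2 ((s # path_states (s', xs)) ! i)" "\<forall>j<i. \<Phi>1 ((s # path_states (s', xs)) ! j)"
    by (auto simp: sat_until_def)
  show ?R
  proof (cases i)
    case 0
    with i show ?thesis by simp
  next
    case (Suc m)
    with i have "\<Phi>1 s" "sat_until \<Phi>1 k \<Phi>2 (s', xs)"
      by (auto simp: sat_until_def all_less_Suc_shift intro!: exI[of _ m])
    then show ?thesis by simp
  qed
next
  assume ?R
  then show ?L
  proof
    assume "\<Phi>2 s"
    then show ?L by (rule sat_until_start)
  next
    assume r: "\<Phi>1 s \<and> sat_until \<Phi>1 k \<Phi>2 (s', xs)"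
    then obtain i where "i \<le> k" "i \<le> path_len (s', xs)"
      "\<Phi>2 (path_states (s', xs) ! i)" "\<forall>j<i. \<Phi>1 (path_states (s', xs) ! j)"
      by (auto simp: sat_until_def)
    with r show ?L
      unfolding sat_until_def by (intro exI[of _ "Suc i"]) (simp add: all_less_Suc_shift)
  qed
qed

lemma until_paths_target: "\<Phi>2 s \<Longrightarrow> until_paths s \<Phi>1 k \<Phi>2 = {(s, [])}"
proof (intro set_eqI iffI)
  fix \<rho> assume *: "\<Phi>2 s" "\<rho> \<in> until_paths s \<Phi>1 k \<Phi>2"
  then have "\<not> 0 < path_len \<rho>"
    by (auto simp: until_paths_def sat_until_Nil)
  with * show "\<rho> \<in> {(s, [])}"
    by (cases \<rho>) (auto simp: until_paths_def path_len_def)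
qed (auto simp: until_paths_def sat_until_Nil)

lemma until_paths_0: "\<not> \<Phi>2 s \<Longrightarrow> until_paths s \<Phi>1 0 \<Phi>2 = {}"
  by (auto simp: until_paths_def sat_until_0)

lemma until_paths_blocked: "\<not> \<Phi>2 s \<Longrightarrow> \<not> \<Phi>1 s \<Longrightarrow> until_paths s \<Phi>1 k \<Phi>2 = {}"
proof -
  assume *: "\<not> \<Phi>2 s" "\<not> \<Phi>1 s"
  have "\<not> sat_until \<Phi>1 k \<Phi>2 (s, xs)" for xs :: "('b \<times> 'a) list"
  proof
    assume "sat_until \<Phi>1 k \<Phi>2 (s, xs)"
    then obtain i where "\<Phi>2 (path_states (s, xs) ! i)" "\<forall>j<i. \<Phi>1 (path_states (s, xs) ! j)"
      by (auto simp: sat_until_def)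
    with * show False by (cases i) (auto simp: all_less_Suc_shift)
  qed
  then show ?thesis by (auto simp: until_paths_def)
qed

text \<open>Minimality passes to the tail: the prefix of length 0 fails because
  \<open>\<Phi>2 s\<close> does, and the prefix of length \<open>Suc n\<close> satisfies the formula
  iff the tail's prefix of length \<open>n\<close> does with bound \<open>k\<close>.\<close>

lemma Cons_in_until_paths:
  assumes "\<not> \<Phi>2 s" "\<Phi>1 s"
  shows "(s, (a, s') # xs) \<in> until_paths s \<Phi>1 (Suc k) \<Phi>2 \<longleftrightarrow>
    (s', xs) \<in> until_paths s' \<Phi>1 k \<Phi>2"
  using assms
  by (simp add: until_paths_def sat_until_Cons all_less_Suc_shift sat_until_Nil)
     (simp add: path_take_def)

lemma until_paths_Suc:
  assumes "\<not> \<Phi>2 s" "\<Phi>1 s"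
  shows "until_paths s \<Phi>1 (Suc k) \<Phi>2 =
    (\<lambda>(a, \<rho>). (s, (a, fst \<rho>) # snd \<rho>)) ` (UNIV \<times> (\<Union>s'. until_paths s' \<Phi>1 k \<Phi>2))"
  (is "?L = ?R")
proof (intro set_eqI iffI)
  fix \<rho> assume L: "\<rho> \<in> ?L"
  then have "fst \<rho> = s" by (simp add: until_paths_def)
  moreover from L assms have "snd \<rho> \<noteq> []"
    by (cases \<rho>) (auto simp: until_paths_def sat_until_Nil)
  ultimately obtain a s' xs where \<rho>: "\<rho> = (s, (a, s') # xs)"
    by (cases \<rho>; cases "snd \<rho>") auto
  with L have "(s', xs) \<in> until_paths s' \<Phi>1 k \<Phi>2"
    by (simp add: Cons_in_until_paths[of \<Phi>2 s \<Phi>1, OF assms])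
  with \<rho> show "\<rho> \<in> ?R" by force
next
  fix \<rho> assume "\<rho> \<in> ?R"
  then obtain a s' \<rho>' where \<rho>: "\<rho> = (s, (a, fst \<rho>') # snd \<rho>')" "\<rho>' \<in> until_paths s' \<Phi>1 k \<Phi>2"
    by auto
  then have "fst \<rho>' = s'" by (simp add: until_paths_def)
  with \<rho> obtain xs where "\<rho>' = (s', xs)" by (cases \<rho>') simp
  with \<rho> show "\<rho> \<in> ?L"
    by (simp add: Cons_in_until_paths[of \<Phi>2 s \<Phi>1, OF assms])
qed

lemma sum_until_paths_Suc:
  fixes F :: "('s::finite, 'a::finite) fpath \<Rightarrow> real"
  assumes "\<not> \<Phi>2 s" "\<Phi>1 s"
  shows "(\<Sum>\<rho>\<in>until_paths s \<Phi>1 (Suc k) \<Phi>2. F \<rho>) =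
    (\<Sum>a\<in>UNIV. \<Sum>s'\<in>UNIV. \<Sum>\<rho>\<in>until_paths s' \<Phi>1 k \<Phi>2. F (s, (a, fst \<rho>) # snd \<rho>))"
proof -
  have inj: "inj_on (\<lambda>(a, \<rho>). (s, (a, fst \<rho>) # snd \<rho>)) X" for X :: "('a \<times> ('s, 'a) fpath) set"
    by (auto simp: inj_on_def)
  have "(\<Sum>\<rho>\<in>until_paths s \<Phi>1 (Suc k) \<Phi>2. F \<rho>) =
      (\<Sum>(a, \<rho>)\<in>UNIV \<times> (\<Union>s'. until_paths s' \<Phi>1 k \<Phi>2). F (s, (a, fst \<rho>) # snd \<rho>))"
    by (subst until_paths_Suc[of \<Phi>2 s \<Phi>1, OF assms], subst sum.reindex[OF inj]) (simp add: case_prod_beta comp_def)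
  also have "\<dots> = (\<Sum>a\<in>UNIV. \<Sum>\<rho>\<in>(\<Union>s'. until_paths s' \<Phi>1 k \<Phi>2). F (s, (a, fst \<rho>) # snd \<rho>))"
    by (simp add: sum.cartesian_product)
  \<comment> \<open>The union over \<open>s'\<close> is disjoint because its members differ in their
    first state.\<close>
  also have "\<dots> = (\<Sum>a\<in>UNIV. \<Sum>s'\<in>UNIV. \<Sum>\<rho>\<in>until_paths s' \<Phi>1 k \<Phi>2. F (s, (a, fst \<rho>) # snd \<rho>))"
    by (intro sum.cong refl sum.UNION_disjoint)
       (auto simp: finite_until_paths, auto simp: until_paths_def)
  finally show ?thesis .
qed

section \<open>Strategies that read only observations\<close>

text \<open>The label of the first state is not read: it may differ between two states related by
  a simulation.\<close>

definition obs_strategy ::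
    "('s, 'a, 'z, 'ap) wa \<Rightarrow> ('z list \<Rightarrow> 'a list \<Rightarrow> 'a) \<Rightarrow> ('s, 'a) fpath \<Rightarrow> 'a" where
  "obs_strategy M g \<rho> = g (map (wa_zlabel M) (map snd (snd \<rho>))) (path_actions \<rho>)"

lemma obs_strategy_Nil [simp]: "obs_strategy M g (s, []) = g [] []"
  by (simp add: obs_strategy_def)

text \<open>The residual has the same form, with the first action and the label of its successor
  absorbed into \<open>g\<close>. Residuals in two automata therefore use the same function whenever
  these labels agree.\<close>

lemma obs_strategy_Cons [simp]:
  "obs_strategy M g (s, (a, s') # xs) =
     obs_strategy M (\<lambda>zs as. g (wa_zlabel M s' # zs) (a # as)) (s', xs)"
  by (simp add: obs_strategy_def)

lemma wa_obs_based_obs_strategy: "wa_obs_based M (obs_strategy M g)"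
  unfolding wa_obs_based_def
proof (intro allI impI, elim conjE)
  fix \<rho> \<rho>' :: "('a, 'b) fpath"
  assume "map (wa_zlabel M) (path_states \<rho>) = map (wa_zlabel M) (path_states \<rho>')"
    and "path_actions \<rho> = path_actions \<rho>'"
  then show "obs_strategy M g \<rho> = obs_strategy M g \<rho>'"
    by (simp add: obs_strategy_def path_states_def)
qed

section \<open>First-step equations for automaton probabilities\<close>

lemma wa_prob_until_target: "\<Phi>2 s \<Longrightarrow> wa_prob_until M \<sigma> s \<Phi>1 k \<Phi>2 = 1"
proof -
  assume "\<Phi>2 s"
  then have "{\<rho>. \<rho> \<in> until_paths s \<Phi>1 k \<Phi>2 \<and> wa_follows \<sigma> \<rho>} = {(s, [])}"
    by (auto simp: until_paths_target)
  then show ?thesis by (simp add: wa_prob_until_def)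
qed

lemma wa_prob_until_0: "\<not> \<Phi>2 s \<Longrightarrow> wa_prob_until M \<sigma> s \<Phi>1 0 \<Phi>2 = 0"
  by (simp add: wa_prob_until_def until_paths_0)

lemma wa_prob_until_blocked: "\<not> \<Phi>2 s \<Longrightarrow> \<not> \<Phi>1 s \<Longrightarrow> wa_prob_until M \<sigma> s \<Phi>1 k \<Phi>2 = 0"
  by (simp add: wa_prob_until_def until_paths_blocked)

text \<open>Moving the adversary's condition into the summand leaves the index set
  \<open>until_paths\<close>, to which the first-step decomposition applies.\<close>

lemma wa_prob_until_conv_if:
  fixes M :: "('s::finite, 'a::finite, 'z, 'ap) wa"
  shows "wa_prob_until M \<sigma> s \<Phi>1 k \<Phi>2 =
    (\<Sum>\<rho>\<in>until_paths s \<Phi>1 k \<Phi>2. if wa_follows \<sigma> \<rho> then path_weight (wa_trans M) \<rho> else 0)"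
proof -
  have "{\<rho>. \<rho> \<in> until_paths s \<Phi>1 k \<Phi>2 \<and> wa_follows \<sigma> \<rho>} =
      until_paths s \<Phi>1 k \<Phi>2 \<inter> {\<rho>. wa_follows \<sigma> \<rho>}" by blast
  then show ?thesis
    by (simp add: wa_prob_until_def sum.inter_restrict[OF finite_until_paths])
qed

lemma wa_prob_until_Suc:
  fixes M :: "('s::finite, 'a::finite, 'z, 'ap) wa"
  assumes "\<not> \<Phi>2 s" "\<Phi>1 s"
  shows "wa_prob_until M (obs_strategy M g) s \<Phi>1 (Suc k) \<Phi>2 =
    (\<Sum>s'\<in>UNIV. wa_trans M s (g [] []) s' *
       wa_prob_until M (obs_strategy M (\<lambda>zs as. g (wa_zlabel M s' # zs) (g [] [] # as)))
         s' \<Phi>1 k \<Phi>2)"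
proof -
  let ?F = "\<lambda>\<sigma> \<rho>. if wa_follows \<sigma> \<rho> then path_weight (wa_trans M) \<rho> else 0"
  let ?g = "\<lambda>a s' zs as. g (wa_zlabel M s' # zs) (a # as)"
  have step: "?F (obs_strategy M g) (s, (a, fst \<rho>) # snd \<rho>) =
      (if a = g [] [] then wa_trans M s a s' * ?F (obs_strategy M (?g a s')) \<rho> else 0)"
    if "\<rho> \<in> until_paths s' \<Phi>1 k \<Phi>2" for a s' \<rho>
  proof -
    have "fst \<rho> = s'" using that by (simp add: until_paths_def)
    then obtain xs where \<rho>: "\<rho> = (s', xs)" by (cases \<rho>) simp
    \<comment> \<open>All prefixes of \<open>(s', xs)\<close> start in \<open>s'\<close>, so the
      label taken at \<open>fst \<rho>\<close> is always that of \<open>s'\<close>.\<close>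
    have "wa_follows (\<lambda>\<rho>. obs_strategy M (\<lambda>zs as. g (wa_zlabel M (fst \<rho>) # zs) (a # as)) \<rho>) (s', xs)
        = wa_follows (obs_strategy M (?g a s')) (s', xs)"
      by (simp add: wa_follows_def path_take_def)
    then show ?thesis by (simp add: \<rho> wa_follows_Cons)
  qed
  have "wa_prob_until M (obs_strategy M g) s \<Phi>1 (Suc k) \<Phi>2 =
     (\<Sum>a\<in>UNIV. \<Sum>s'\<in>UNIV. \<Sum>\<rho>\<in>until_paths s' \<Phi>1 k \<Phi>2.
        if a = g [] [] then wa_trans M s a s' * ?F (obs_strategy M (?g a s')) \<rho> else 0)"
    unfolding wa_prob_until_conv_if sum_until_paths_Suc[of \<Phi>2 s \<Phi>1, OF assms]
    by (intro sum.cong refl step)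
  also have "\<dots> = (\<Sum>a\<in>UNIV. if a = g [] [] then
      (\<Sum>s'\<in>UNIV. wa_trans M s a s' *
         wa_prob_until M (obs_strategy M (?g a s')) s' \<Phi>1 k \<Phi>2) else 0)"
    by (intro sum.cong refl) (simp add: wa_prob_until_conv_if sum_distrib_left)
  finally show ?thesis by simp
qed

lemma wa_prob_until_nonneg:
  assumes "\<And>s a s'. 0 \<le> wa_trans M s a s'"
  shows "0 \<le> wa_prob_until M \<sigma> s \<Phi>1 k \<Phi>2"
  unfolding wa_prob_until_def path_weight_def
  by (intro sum_nonneg prod_nonneg assms)

text \<open>Row sums of at most 1 keep the first-step average at most 1. This bounds the value of a
  simulated state when the simulating state meets the target at once.\<close>

lemma wa_prob_until_le_1:
  fixes M :: "('s::finite, 'a::finite, 'z, 'ap) wa"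
  assumes nonneg: "\<And>s a s'. 0 \<le> wa_trans M s a s'"
    and sub: "\<And>s a. (\<Sum>s'\<in>UNIV. wa_trans M s a s') \<le> 1"
  shows "wa_prob_until M (obs_strategy M g) s \<Phi>1 k \<Phi>2 \<le> 1"
proof (induction k arbitrary: g s)
  case 0
  show ?case
    by (cases "\<Phi>2 s") (simp_all add: wa_prob_until_target wa_prob_until_0)
next
  case (Suc k)
  show ?case
  proof (cases "\<not> \<Phi>2 s \<and> \<Phi>1 s")
    case True
    then have "\<not> \<Phi>2 s" "\<Phi>1 s" by auto
    then have "wa_prob_until M (obs_strategy M g) s \<Phi>1 (Suc k) \<Phi>2 \<le>
        (\<Sum>s'\<in>UNIV. wa_trans M s (g [] []) s' * 1)"
      unfolding wa_prob_until_Suc[of \<Phi>2 s \<Phi>1, OF \<open>\<not> \<Phi>2 s\<close> \<open>\<Phi>1 s\<close>]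
      by (intro sum_mono mult_left_mono Suc nonneg)
    with sub[of s "g [] []"] show ?thesis by simp
  next
    case False
    then show ?thesis
      by (cases "\<Phi>2 s") (simp_all add: wa_prob_until_target wa_prob_until_blocked)
  qed
qed

section \<open>Simulation increases the probability of bounded until\<close>

lemma safe_simulation_step:
  assumes "safe_simulation M1 M2 R" "(s1, s2) \<in> R"
  obtains w where "\<And>x y. 0 \<le> w x y"
    "\<And>x. wa_trans M1 s1 a x = (\<Sum>y\<in>UNIV. w x y)"
    "\<And>y. (\<Sum>x\<in>UNIV. w x y) \<le> wa_trans M2 s2 a y"
    "\<And>x y. 0 < w x y \<Longrightarrow>
       (x, y) \<in> R \<and> wa_label M1 x = wa_label M2 y \<and> wa_zlabel M1 x = wa_zlabel M2 y"
proof -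
  from assms have "\<exists>\<mu>2. wa_step M2 s2 a \<mu>2 \<and> dominated M1 M2 R (wa_trans M1 s1 a) \<mu>2"
    unfolding safe_simulation_def by (auto simp: wa_step_def)
  \<comment> \<open>\<open>wa_step\<close> determines its distribution, so \<open>\<mu>2\<close> is
    the transition row of \<open>s2\<close>.\<close>
  then have "dominated M1 M2 R (wa_trans M1 s1 a) (wa_trans M2 s2 a)"
    by (metis ext wa_step_def)
  then obtain w where
      "\<forall>x y. w x y \<in> {0..1}" "\<forall>x. wa_trans M1 s1 a x = (\<Sum>y\<in>UNIV. w x y)"
      "\<forall>y. wa_trans M2 s2 a y \<ge> (\<Sum>x\<in>UNIV. w x y)"
      "\<forall>x y. wa_zlabel M1 x \<noteq> wa_zlabel M2 y \<or> wa_label M1 x \<noteq> wa_label M2 y \<longrightarrow> w x y = 0"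
      "\<forall>x y. w x y > 0 \<longrightarrow> (x, y) \<in> R"
    unfolding dominated_def by blast
  then show thesis
    by (intro that[of w]) (simp, blast, blast, metis less_irrefl)
qed

text \<open>Both sides use the same \<open>g\<close>. Monotonicity of the state predicates is asked
  only of related pairs with equal propositions, and \<open>w\<close> gives positive weight only to
  such pairs.\<close>

lemma wa_prob_until_simulation:
  fixes M1 :: "('s::finite, 'a::finite, 'z, 'ap) wa"
    and M2 :: "('t::finite, 'a, 'z, 'ap) wa"
  assumes sim: "safe_simulation M1 M2 R"
    and nonneg1: "\<And>s a s'. 0 \<le> wa_trans M1 s a s'"
    and sub1: "\<And>s a. (\<Sum>s'\<in>UNIV. wa_trans M1 s a s') \<le> 1"
    and nonneg2: "\<And>s a s'. 0 \<le> wa_trans M2 s a s'"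
    and mono1: "\<And>x y. (x, y) \<in> R \<Longrightarrow> wa_label M1 x = wa_label M2 y \<Longrightarrow> \<Phi>1 x \<Longrightarrow> \<Psi>1 y"
    and mono2: "\<And>x y. (x, y) \<in> R \<Longrightarrow> wa_label M1 x = wa_label M2 y \<Longrightarrow> \<Phi>2 x \<Longrightarrow> \<Psi>2 y"
    and "(s, t) \<in> R" "wa_label M1 s = wa_label M2 t"
  shows "wa_prob_until M1 (obs_strategy M1 g) s \<Phi>1 k \<Phi>2 \<le>
    wa_prob_until M2 (obs_strategy M2 g) t \<Psi>1 k \<Psi>2"
  using assms(7,8)
proof (induction k arbitrary: g s t)
  case 0
  show ?case
  proof (cases "\<Phi>2 s")
    case True
    with mono2 0 show ?thesis by (simp add: wa_prob_until_target)
  next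
    case False
    with nonneg2 show ?thesis by (simp add: wa_prob_until_0 wa_prob_until_nonneg)
  qed
next
  case (Suc k)
  note R = Suc.prems
  \<comment> \<open>By \<open>mono2\<close>, \<open>\<not> \<Psi>2 t\<close> already excludes
    \<open>\<Phi>2 s\<close>. The first case includes states \<open>s\<close> outside the target:
    paths of \<open>M2\<close> stop there while those of \<open>M1\<close> may go on.\<close>
  consider "\<Psi>2 t" | "\<not> \<Psi>2 t" "\<not> \<Phi>2 s" "\<not> \<Phi>1 s" | "\<not> \<Psi>2 t" "\<not> \<Phi>2 s" "\<Phi>1 s"
    using mono2[OF R] by blast
  then show ?case
  proof cases
    case 1
    then show ?thesis
      using nonneg1 sub1 by (simp add: wa_prob_until_target wa_prob_until_le_1)
  next
    case 2
    then show ?thesis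
      using nonneg2 by (simp add: wa_prob_until_blocked wa_prob_until_nonneg)
  next
    case 3
    define a where "a = g [] []"
    define V1 where "V1 x = wa_prob_until M1
      (obs_strategy M1 (\<lambda>zs as. g (wa_zlabel M1 x # zs) (a # as))) x \<Phi>1 k \<Phi>2" for x
    define V2 where "V2 y = wa_prob_until M2
      (obs_strategy M2 (\<lambda>zs as. g (wa_zlabel M2 y # zs) (a # as))) y \<Psi>1 k \<Psi>2" for y
    obtain w where w: "\<And>x y. 0 \<le> w x y"
      "\<And>x. wa_trans M1 s a x = (\<Sum>y\<in>UNIV. w x y)"
      "\<And>y. (\<Sum>x\<in>UNIV. w x y) \<le> wa_trans M2 t a y"
      "\<And>x y. 0 < w x y \<Longrightarrow>
         (x, y) \<in> R \<and> wa_label M1 x = wa_label M2 y \<and> wa_zlabel M1 x = wa_zlabel M2 y"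
      using safe_simulation_step[OF sim R(1), of a] by metis
    \<comment> \<open>Positive weight forces equal observation labels, so \<open>V1 x\<close> and
      \<open>V2 y\<close> use the same residual function and the induction hypothesis applies. At
      weight 0 both sides vanish.\<close>
    have le: "w x y * V1 x \<le> w x y * V2 y" for x y
    proof (cases "w x y = 0")
      case False
      with w(1)[of x y] have "0 < w x y" by simp
      with w(4)[of x y] Suc.IH[of x y] have "V1 x \<le> V2 y" by (simp add: V1_def V2_def)
      with w(1) show ?thesis by (simp add: mult_left_mono)
    qed simp
    have "wa_prob_until M1 (obs_strategy M1 g) s \<Phi>1 (Suc k) \<Phi>2 =
        (\<Sum>x\<in>UNIV. wa_trans M1 s a x * V1 x)"
      using 3 by (simp add: wa_prob_until_Suc V1_def a_def)
    also have "\<dots> = (\<Sum>x\<in>UNIV. \<Sum>y\<in>UNIV. w x y * V1 x)"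
      by (simp add: w(2) sum_distrib_right)
    also have "\<dots> \<le> (\<Sum>x\<in>UNIV. \<Sum>y\<in>UNIV. w x y * V2 y)"
      by (intro sum_mono le)
    also have "\<dots> = (\<Sum>y\<in>UNIV. (\<Sum>x\<in>UNIV. w x y) * V2 y)"
      by (subst sum.swap) (simp add: sum_distrib_right)
    also have "\<dots> \<le> (\<Sum>y\<in>UNIV. wa_trans M2 t a y * V2 y)"
      using nonneg2 by (intro sum_mono mult_right_mono w) (simp add: V2_def wa_prob_until_nonneg)
    also have "\<dots> = wa_prob_until M2 (obs_strategy M2 g) t \<Psi>1 (Suc k) \<Psi>2"
      using 3 mono1[OF R] by (simp add: wa_prob_until_Suc V2_def a_def)
    finally show ?thesis .
  qed
qed

section \<open>POMDP probabilities as averages over the first emission\<close>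

text \<open>An observation-based adversary is constrained only on sequences that the path can emit;
  \<open>SOME\<close> is applied only to pairs realised by some path.\<close>

lemma pomdp_obs_based_factors:
  assumes "pomdp_obs_based P \<sigma>"
  obtains f where "\<And>\<rho> zs. emits P \<rho> zs \<Longrightarrow> \<sigma> \<rho> zs = f zs (path_actions \<rho>)"
proof
  fix \<rho> zs assume *: "emits P \<rho> zs"
  let ?Q = "\<lambda>\<rho>'. emits P \<rho>' zs \<and> path_actions \<rho>' = path_actions \<rho>"
  have "?Q (SOME \<rho>'. ?Q \<rho>')" by (rule someI[of ?Q \<rho>]) (simp add: *)
  with * assms show "\<sigma> \<rho> zs =
      (\<lambda>zs as. \<sigma> (SOME \<rho>'. emits P \<rho>' zs \<and> path_actions \<rho>' = as) zs) zs (path_actions \<rho>)"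
    unfolding pomdp_obs_based_def by metis
qed

lemma emits_path_take:
  assumes "emits P \<rho> zs" "i < path_len \<rho>"
  shows "emits P (path_take i \<rho>) (take (Suc i) zs)"
proof -
  \<comment> \<open>A path with \<open>i\<close> steps visits \<open>i + 1\<close> states, hence
    \<open>Suc i\<close>.\<close>
  have "path_states (path_take i \<rho>) = take (Suc i) (path_states \<rho>)"
    by (simp add: path_states_def path_take_def take_map)
  with assms show ?thesis
    by (simp add: emits_def list_all2_takeI)
qed

text \<open>The adversary is consulted only on sequences that can be emitted, since prefixes of such
  sequences can be emitted too. A function of observations and actions can thus replace it.\<close>

lemma pomdp_prob_until_cong:
  assumes "\<And>\<rho> zs. emits P \<rho> zs \<Longrightarrow> \<sigma> \<rho> zs = \<tau> \<rho> zs"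
  shows "pomdp_prob_until P \<sigma> s \<Phi>1 k \<Phi>2 = pomdp_prob_until P \<tau> s \<Phi>1 k \<Phi>2"
proof -
  have "pomdp_follows \<sigma> \<rho> zs \<longleftrightarrow> pomdp_follows \<tau> \<rho> zs" if "emits P \<rho> zs" for \<rho> zs
    using assms emits_path_take[OF that] by (simp add: pomdp_follows_def)
  then have "{zs. emits P \<rho> zs \<and> pomdp_follows \<sigma> \<rho> zs} =
      {zs. emits P \<rho> zs \<and> pomdp_follows \<tau> \<rho> zs}" for \<rho> by blast
  then show ?thesis by (simp add: pomdp_prob_until_def)
qed

section \<open>Recursion over the emissions along a path\<close>

lemma emission_prob_Nil: "emission_prob P (s, []) [z] = pomdp_obs P s z"
  by (simp add: emission_prob_def)

lemma emission_prob_Cons: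
  "emission_prob P (s, (a, s') # xs) (z # zs) = pomdp_obs P s z * emission_prob P (s', xs) zs"
  by (simp add: emission_prob_def prod.atMost_Suc_shift del: prod.atMost_Suc)

lemma pomdp_follows_Cons:
  "pomdp_follows (\<lambda>\<rho> zs. f zs (path_actions \<rho>)) (s, (a, s') # xs) (z # zs) \<longleftrightarrow>
     a = f [z] [] \<and>
     pomdp_follows (\<lambda>\<rho> zs. f (z # zs) (a # path_actions \<rho>)) (s', xs) zs"
  by (simp add: pomdp_follows_def all_less_Suc_shift) (simp add: path_take_def path_actions_def)

text \<open>Ranging over all sequences of the right length, rather than those that can be emitted,
  makes the recursion uniform.\<close>

definition observed_weight ::
    "('s, 'a, 'z::finite, 'ap) pomdp \<Rightarrow> ('z list \<Rightarrow> 'a list \<Rightarrow> 'a) \<Rightarrow> ('s, 'a) fpath \<Rightarrow> real" where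
  "observed_weight P f \<rho> =
     (\<Sum>zs | length zs = Suc (path_len \<rho>) \<and> pomdp_follows (\<lambda>\<rho> zs. f zs (path_actions \<rho>)) \<rho> zs.
        path_weight (pomdp_trans P) \<rho> * emission_prob P \<rho> zs)"

lemma finite_length_eq: "finite {zs :: 'z::finite list. length zs = n \<and> Q zs}"
  by (rule finite_subset[OF _ finite_lists_length_eq[of UNIV n]]) auto

lemma pomdp_prob_until_observed_weight:
  fixes P :: "('s::finite, 'a::finite, 'z::finite, 'ap) pomdp"
  assumes nonneg: "\<And>s z. 0 \<le> pomdp_obs P s z"
  shows "pomdp_prob_until P (\<lambda>\<rho> zs. f zs (path_actions \<rho>)) s \<Phi>1 k \<Phi>2 =
    (\<Sum>\<rho>\<in>until_paths s \<Phi>1 k \<Phi>2. observed_weight P f \<rho>)"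
proof -
  let ?fol = "pomdp_follows (\<lambda>\<rho> zs. f zs (path_actions \<rho>))"
  have "(\<Sum>zs | emits P \<rho> zs \<and> ?fol \<rho> zs. path_weight (pomdp_trans P) \<rho> * emission_prob P \<rho> zs) =
      observed_weight P f \<rho>" for \<rho>
    unfolding observed_weight_def
  proof (rule sum.mono_neutral_left)
    have len: "length (path_states \<rho>) = Suc (path_len \<rho>)"
      by (simp add: path_states_def path_len_def)
    then show "{zs. emits P \<rho> zs \<and> ?fol \<rho> zs} \<subseteq>
        {zs. length zs = Suc (path_len \<rho>) \<and> ?fol \<rho> zs}"
      by (auto simp: emits_def dest: list_all2_lengthD)
    show "\<forall>zs\<in>{zs. length zs = Suc (path_len \<rho>) \<and> ?fol \<rho> zs} -
        {zs. emits P \<rho> zs \<and> ?fol \<rho> zs}.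
      path_weight (pomdp_trans P) \<rho> * emission_prob P \<rho> zs = 0"
    proof
      fix zs
      assume "zs \<in> {zs. length zs = Suc (path_len \<rho>) \<and> ?fol \<rho> zs} -
        {zs. emits P \<rho> zs \<and> ?fol \<rho> zs}"
      \<comment> \<open>A sequence of the right length that cannot be emitted has a position of
        nonpositive emission probability; by nonnegativity it is a zero factor of
        \<open>emission_prob\<close>.\<close>
      then obtain i where "i \<le> path_len \<rho>" "\<not> 0 < pomdp_obs P (path_states \<rho> ! i) (zs ! i)"
        using len by (auto simp: emits_def list_all2_conv_all_nth less_Suc_eq_le)
      with nonneg have "i \<le> path_len \<rho>" "pomdp_obs P (path_states \<rho> ! i) (zs ! i) = 0"
        by (auto simp: order_less_le)
      then show "path_weight (pomdp_trans P) \<rho> * emission_prob P \<rho> zs = 0"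
        by (auto simp: emission_prob_def)
    qed
  qed (rule finite_length_eq)
  then show ?thesis by (simp add: pomdp_prob_until_def)
qed

lemma observed_weight_Nil:
  "observed_weight P f (s, []) = (\<Sum>z\<in>UNIV. pomdp_obs P s z)"
proof -
  have "{zs :: 'c list. length zs = 1 \<and> pomdp_follows (\<lambda>\<rho> zs. f zs (path_actions \<rho>)) (s, []) zs}
      = (\<lambda>z. [z]) ` UNIV"
    by (auto simp: pomdp_follows_def length_Suc_conv)
  then show ?thesis
    by (simp add: observed_weight_def sum.reindex inj_on_def emission_prob_Nil)
qed

text \<open>The first action depends on the emission \<open>z\<close> of \<open>s\<close>, so the
  test on \<open>a\<close> must stay inside the sum over \<open>z\<close>.\<close>

lemma observed_weight_Cons:
  "observed_weight P f (s, (a, s') # xs) =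
     (\<Sum>z\<in>UNIV. if a = f [z] [] then pomdp_obs P s z * (pomdp_trans P s a s' *
        observed_weight P (\<lambda>zs as. f (z # zs) (a # as)) (s', xs)) else 0)"
proof -
  let ?n = "Suc (path_len (s', xs))"
  let ?W = "\<lambda>z. {zs. length zs = ?n \<and>
    pomdp_follows (\<lambda>\<rho> zs. f (z # zs) (a # path_actions \<rho>)) (s', xs) zs}"
  let ?A = "\<lambda>z. if a = f [z] [] then ?W z else {}"
  have eq: "{zs. length zs = Suc ?n \<and>
        pomdp_follows (\<lambda>\<rho> zs. f zs (path_actions \<rho>)) (s, (a, s') # xs) zs} =
      (\<lambda>(z, zs). z # zs) ` (SIGMA z:UNIV. ?A z)"
  proof (intro set_eqI iffI)
    fix ys assume ys: "ys \<in> {zs. length zs = Suc ?n \<and>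
        pomdp_follows (\<lambda>\<rho> zs. f zs (path_actions \<rho>)) (s, (a, s') # xs) zs}"
    then obtain z zs where "ys = z # zs" by (cases ys) auto
    with ys show "ys \<in> (\<lambda>(z, zs). z # zs) ` (SIGMA z:UNIV. ?A z)"
      by (auto simp: pomdp_follows_Cons intro!: image_eqI[of _ _ "(z, zs)"])
  qed (auto simp: pomdp_follows_Cons split: if_splits)
  have inj: "inj_on (\<lambda>(z, zs). z # zs) X" for X :: "('c \<times> 'c list) set"
    by (auto simp: inj_on_def)
  have "observed_weight P f (s, (a, s') # xs) = (\<Sum>(z, zs)\<in>(SIGMA z:UNIV. ?A z).
      pomdp_trans P s a s' * path_weight (pomdp_trans P) (s', xs) *
        (pomdp_obs P s z * emission_prob P (s', xs) zs))"
    unfolding observed_weight_def path_len_Cons eq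
    by (subst sum.reindex[OF inj]) (simp add: case_prod_beta comp_def emission_prob_Cons)
  also have "\<dots> = (\<Sum>z\<in>UNIV. \<Sum>zs\<in>?A z.
      pomdp_trans P s a s' * path_weight (pomdp_trans P) (s', xs) *
        (pomdp_obs P s z * emission_prob P (s', xs) zs))"
    by (rule sum.Sigma[symmetric]) (auto simp: finite_length_eq)
  also have "\<dots> = (\<Sum>z\<in>UNIV. if a = f [z] [] then pomdp_obs P s z * (pomdp_trans P s a s' *
        observed_weight P (\<lambda>zs as. f (z # zs) (a # as)) (s', xs)) else 0)"
    by (intro sum.cong refl)
       (simp add: observed_weight_def sum_distrib_left mult.assoc mult.left_commute)
  finally show ?thesis .
qed

text \<open>Once the sum over \<open>z\<close> is outermost, the sum over \<open>a\<close> collapses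
  to the single action \<open>f [z] []\<close> chosen after that emission.\<close>

lemma sum_observed_weight_Suc:
  fixes P :: "('s::finite, 'a::finite, 'z::finite, 'ap) pomdp"
  assumes "\<not> \<Phi>2 s" "\<Phi>1 s"
  shows "(\<Sum>\<rho>\<in>until_paths s \<Phi>1 (Suc k) \<Phi>2. observed_weight P f \<rho>) =
    (\<Sum>z\<in>UNIV. pomdp_obs P s z * (\<Sum>s'\<in>UNIV. pomdp_trans P s (f [z] []) s' *
       (\<Sum>\<rho>\<in>until_paths s' \<Phi>1 k \<Phi>2. observed_weight P (\<lambda>zs as. f (z # zs) (f [z] [] # as)) \<rho>)))"
proof -
  let ?B = "\<lambda>a z s' \<rho>. pomdp_obs P s z * (pomdp_trans P s a s' *
        observed_weight P (\<lambda>zs as. f (z # zs) (a # as)) \<rho>)"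
  have step: "observed_weight P f (s, (a, fst \<rho>) # snd \<rho>) =
      (\<Sum>z\<in>UNIV. if a = f [z] [] then ?B a z s' \<rho> else 0)"
    if "\<rho> \<in> until_paths s' \<Phi>1 k \<Phi>2" for a s' \<rho>
  proof -
    have "\<rho> = (s', snd \<rho>)" using that by (simp add: until_paths_def prod_eq_iff)
    then obtain xs where \<rho>: "\<rho> = (s', xs)" by blast
    show ?thesis unfolding \<rho> by (simp add: observed_weight_Cons)
  qed
  have "(\<Sum>\<rho>\<in>until_paths s \<Phi>1 (Suc k) \<Phi>2. observed_weight P f \<rho>) =
      (\<Sum>a\<in>UNIV. \<Sum>s'\<in>UNIV. \<Sum>\<rho>\<in>until_paths s' \<Phi>1 k \<Phi>2.
        \<Sum>z\<in>UNIV. if a = f [z] [] then ?B a z s' \<rho> else 0)"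
    unfolding sum_until_paths_Suc[of \<Phi>2 s \<Phi>1, OF assms] by (intro sum.cong refl step)
  also have "\<dots> = (\<Sum>a\<in>UNIV. \<Sum>s'\<in>UNIV. \<Sum>z\<in>UNIV. \<Sum>\<rho>\<in>until_paths s' \<Phi>1 k \<Phi>2.
        if a = f [z] [] then ?B a z s' \<rho> else 0)"
    by (intro sum.cong refl sum.swap)
  also have "\<dots> = (\<Sum>a\<in>UNIV. \<Sum>z\<in>UNIV. \<Sum>s'\<in>UNIV. \<Sum>\<rho>\<in>until_paths s' \<Phi>1 k \<Phi>2.
        if a = f [z] [] then ?B a z s' \<rho> else 0)"
    by (intro sum.cong refl sum.swap)
  also have "\<dots> = (\<Sum>z\<in>UNIV. \<Sum>a\<in>UNIV. \<Sum>s'\<in>UNIV. \<Sum>\<rho>\<in>until_paths s' \<Phi>1 k \<Phi>2.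
        if a = f [z] [] then ?B a z s' \<rho> else 0)"
    by (rule sum.swap)
  also have "\<dots> = (\<Sum>z\<in>UNIV. \<Sum>a\<in>UNIV. if a = f [z] [] then
        (\<Sum>s'\<in>UNIV. \<Sum>\<rho>\<in>until_paths s' \<Phi>1 k \<Phi>2. ?B a z s' \<rho>) else 0)"
    by (intro sum.cong refl) simp
  also have "\<dots> = (\<Sum>z\<in>UNIV. \<Sum>s'\<in>UNIV. \<Sum>\<rho>\<in>until_paths s' \<Phi>1 k \<Phi>2. ?B (f [z] []) z s' \<rho>)"
    by simp
  finally show ?thesis by (simp add: sum_distrib_left)
qed

section \<open>From POMDP sums to the corresponding automaton\<close>

lemma sum_UNIV_option:
  fixes h :: "'b::finite option \<Rightarrow> real"
  shows "(\<Sum>y\<in>UNIV. h y) = h None + (\<Sum>x\<in>UNIV. h (Some x))"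
  by (simp add: UNIV_option_conv sum.reindex)

text \<open>No transition enters \<open>None\<close>, so that summand vanishes; the remaining
  weights split into the choice of \<open>s'\<close> followed by its emission.\<close>

lemma sum_trans_corresponding_wa:
  fixes P :: "('s::finite, 'a::finite, 'z::finite, 'ap) pomdp"
  shows "(\<Sum>y\<in>UNIV. wa_trans (corresponding_wa P) x a y * h y) =
    (\<Sum>s'\<in>UNIV. pomdp_trans P (split_state P x) a s' *
       (\<Sum>z'\<in>UNIV. pomdp_obs P s' z' * h (Some (s', z'))))"
  by (simp add: sum_UNIV_option corresponding_wa_def sum_distrib_left mult.assoc
        sum.cartesian_product case_prod_beta flip: UNIV_Times_UNIV)

lemma split_state_Some [simp]: "split_state P (Some (s, z)) = s"
  by (simp add: split_state_def)

text \<open>The start \<open>x z\<close> may depend on the first emission, since after one step the automaton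
  is in the state \<open>[s', z']\<close> that records it.\<close>

lemma sum_observed_weight_corresponding_wa:
  fixes P :: "('s::finite, 'a::finite, 'z::finite, 'ap) pomdp"
  assumes "\<And>z. split_state P (x z) = s"
  shows "(\<Sum>\<rho>\<in>until_paths s \<Phi>1 k \<Phi>2. observed_weight P f \<rho>) =
    (\<Sum>z\<in>UNIV. pomdp_obs P s z *
       wa_prob_until (corresponding_wa P)
         (obs_strategy (corresponding_wa P) (\<lambda>zs as. f (z # map the zs) as))
         (x z) (\<lambda>y. \<Phi>1 (split_state P y)) k (\<lambda>y. \<Phi>2 (split_state P y)))"
  using assms
proof (induction k arbitrary: f s x)
  case 0
  then show ?case
    by (cases "\<Phi>2 s")
       (simp_all add: until_paths_target wa_prob_until_target observed_weight_Nil
          until_paths_0 wa_prob_until_0)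
next
  case (Suc k)
  consider "\<Phi>2 s" | "\<not> \<Phi>2 s" "\<not> \<Phi>1 s" | "\<not> \<Phi>2 s" "\<Phi>1 s" by blast
  then show ?case
  proof cases
    case 1
    with Suc.prems show ?thesis
      by (simp add: until_paths_target wa_prob_until_target observed_weight_Nil)
  next
    case 2
    with Suc.prems show ?thesis
      by (simp add: until_paths_blocked wa_prob_until_blocked)
  next
    case 3
    \<comment> \<open>\<open>map the\<close> strips the \<open>Some\<close>, so a label
      \<open>Some z\<close> read in the automaton reaches \<open>f\<close> as
      \<open>z\<close>.\<close>
    have zlabel: "wa_zlabel (corresponding_wa P) (Some (s, z)) = Some z" for s z
      by (simp add: corresponding_wa_def)
    note IH = Suc.IH[of "\<lambda>z. Some (s', z)" s' for s', OF split_state_Some]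
    show ?thesis
      using 3 Suc.prems
      by (simp add: sum_observed_weight_Suc wa_prob_until_Suc sum_trans_corresponding_wa zlabel IH)
  qed
qed

text \<open>The average is at most the maximum, which is attained on a finite type. This serves to
  fix the first emission, which an automaton strategy does not read.\<close>

lemma weighted_average_attained:
  fixes c v :: "'b::finite \<Rightarrow> real"
  assumes "\<And>z. 0 \<le> c z" "(\<Sum>z\<in>UNIV. c z) = 1"
  obtains z where "(\<Sum>z\<in>UNIV. c z * v z) \<le> v z"
proof -
  have "Max (range v) \<in> range v" by (rule Max_in) auto
  then obtain z where z: "v z = Max (range v)" by (metis imageE)
  have "(\<Sum>y\<in>UNIV. c y * v y) \<le> (\<Sum>y\<in>UNIV. c y * v z)"
    by (intro sum_mono mult_left_mono assms) (simp add: z)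
  also have "\<dots> = v z" using assms(2) by (simp flip: sum_distrib_right)
  finally show thesis by (rule that)
qed

section \<open>Preservation of safe formulas\<close>

lemma corresponding_wa_nonneg:
  "is_pomdp P \<Longrightarrow> 0 \<le> wa_trans (corresponding_wa P) x a y"
  by (auto simp: is_pomdp_def corresponding_wa_def split: option.split)

lemma corresponding_wa_stochastic:
  "is_pomdp P \<Longrightarrow> (\<Sum>y\<in>UNIV. wa_trans (corresponding_wa P) x a y) = 1"
  using sum_trans_corresponding_wa[of P x a "\<lambda>_. 1"] by (simp add: is_pomdp_def)

lemma pomdp_prob_until_simulation:
  fixes P :: "('s::finite, 'a::finite, 'z::finite, 'ap) pomdp"
    and M2 :: "('t::finite, 'a, 'z option, 'ap) wa"
  assumes P: "is_pomdp P" and M2: "is_wa M2"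
    and sim: "safe_simulation (corresponding_wa P) M2 R"
    and mono1: "\<And>x y. (x, y) \<in> R \<Longrightarrow> pomdp_label P (split_state P x) = wa_label M2 y \<Longrightarrow>
      \<Phi>1 (split_state P x) \<Longrightarrow> \<Psi>1 y"
    and mono2: "\<And>x y. (x, y) \<in> R \<Longrightarrow> pomdp_label P (split_state P x) = wa_label M2 y \<Longrightarrow>
      \<Phi>2 (split_state P x) \<Longrightarrow> \<Psi>2 y"
    and R: "(x, t) \<in> R" "pomdp_label P (split_state P x) = wa_label M2 t"
    and \<sigma>: "pomdp_obs_based P \<sigma>"
  obtains \<tau> where "wa_obs_based M2 \<tau>"
    "pomdp_prob_until P \<sigma> (split_state P x) \<Phi>1 k \<Phi>2 \<le> wa_prob_until M2 \<tau> t \<Psi>1 k \<Psi>2"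
proof -
  let ?M1 = "corresponding_wa P"
  have label: "wa_label ?M1 y = pomdp_label P (split_state P y)" for y
    by (simp add: corresponding_wa_def)
  have obs: "\<And>s z. 0 \<le> pomdp_obs P s z" "\<And>s. (\<Sum>z\<in>UNIV. pomdp_obs P s z) = 1"
    using P by (auto simp: is_pomdp_def)
  obtain f where f: "\<And>\<rho> zs. emits P \<rho> zs \<Longrightarrow> \<sigma> \<rho> zs = f zs (path_actions \<rho>)"
    using pomdp_obs_based_factors[OF \<sigma>] by blast
  \<comment> \<open>The first emission is hard-wired as \<open>z\<close>. At states of
    \<open>M2\<close> labelled \<open>None\<close>, \<open>the None\<close> is some fixed
    observation, and the strategy is still observation-based.\<close>
  define g where "g z = (\<lambda>zs as. f (z # map the zs) as)" for z
  define v where "v z = wa_prob_until ?M1 (obs_strategy ?M1 (g z)) x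
    (\<lambda>y. \<Phi>1 (split_state P y)) k (\<lambda>y. \<Phi>2 (split_state P y))" for z
  have "pomdp_prob_until P \<sigma> (split_state P x) \<Phi>1 k \<Phi>2 =
      pomdp_prob_until P (\<lambda>\<rho> zs. f zs (path_actions \<rho>)) (split_state P x) \<Phi>1 k \<Phi>2"
    by (rule pomdp_prob_until_cong) (rule f)
  also have "\<dots> = (\<Sum>z\<in>UNIV. pomdp_obs P (split_state P x) z * v z)"
    by (simp add: pomdp_prob_until_observed_weight obs(1)
          sum_observed_weight_corresponding_wa[of P "\<lambda>_. x"] v_def g_def)
  finally obtain z where "pomdp_prob_until P \<sigma> (split_state P x) \<Phi>1 k \<Phi>2 \<le> v z"
    using weighted_average_attained[of "pomdp_obs P (split_state P x)" v] obs by metis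
  also have "v z \<le> wa_prob_until M2 (obs_strategy M2 (g z)) t \<Psi>1 k \<Psi>2"
    unfolding v_def
  proof (rule wa_prob_until_simulation[OF sim])
    show "0 \<le> wa_trans M2 s a s'" for s a s' using M2 by (auto simp: is_wa_def)
  qed (use R in \<open>auto simp: label corresponding_wa_nonneg[OF P] corresponding_wa_stochastic[OF P]
        intro: mono1 mono2\<close>)
  finally show thesis using that wa_obs_based_obs_strategy by blast
qed

lemma in_bound_mono: "in_bound b y p \<Longrightarrow> x \<le> y \<Longrightarrow> in_bound b x p"
  by (cases b) auto

text \<open>Every POMDP adversary has a counterpart in \<open>M2\<close> with at least its value, so
  an upper bound over all adversaries of \<open>M2\<close> passes to \<open>P\<close>. The argument
  formulas go the other way, from \<open>P\<close> to \<open>M2\<close>.\<close>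

lemma PUntil_simulation:
  fixes P :: "('s::finite, 'a::finite, 'z::finite, 'ap) pomdp"
    and M2 :: "('t::finite, 'a, 'z option, 'ap) wa"
  assumes "is_pomdp P" "is_wa M2" "safe_simulation (corresponding_wa P) M2 R"
    and "\<And>x y. (x, y) \<in> R \<Longrightarrow> pomdp_label P (split_state P x) = wa_label M2 y \<Longrightarrow>
      pomdp_sat P \<phi>1 (split_state P x) \<Longrightarrow> wa_sat M2 \<phi>1 y"
    and "\<And>x y. (x, y) \<in> R \<Longrightarrow> pomdp_label P (split_state P x) = wa_label M2 y \<Longrightarrow>
      pomdp_sat P \<phi>2 (split_state P x) \<Longrightarrow> wa_sat M2 \<phi>2 y"
    and "(x, t) \<in> R" "pomdp_label P (split_state P x) = wa_label M2 t"
    and sat: "wa_sat M2 (PUntil b p \<phi>1 k \<phi>2) t"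
  shows "pomdp_sat P (PUntil b p \<phi>1 k \<phi>2) (split_state P x)"
proof -
  have "in_bound b (pomdp_prob_until P \<sigma> (split_state P x) (pomdp_sat P \<phi>1) k (pomdp_sat P \<phi>2)) p"
    if \<sigma>: "pomdp_obs_based P \<sigma>" for \<sigma>
  proof -
    obtain \<tau> where "wa_obs_based M2 \<tau>"
      "pomdp_prob_until P \<sigma> (split_state P x) (pomdp_sat P \<phi>1) k (pomdp_sat P \<phi>2)
        \<le> wa_prob_until M2 \<tau> t (wa_sat M2 \<phi>1) k (wa_sat M2 \<phi>2)"
      by (rule pomdp_prob_until_simulation[where ?\<Phi>1.0 = "pomdp_sat P \<phi>1" and ?\<Phi>2.0 = "pomdp_sat P \<phi>2"
            and ?\<Psi>1.0 = "wa_sat M2 \<phi>1" and ?\<Psi>2.0 = "wa_sat M2 \<phi>2", OF assms(1-7) \<sigma>])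
    with sat show ?thesis using in_bound_mono by fastforce
  qed
  then show ?thesis by simp
qed

text \<open>Negation reverses \<open>PUntil_simulation\<close>, whose premises on
  \<open>\<phi>1\<close> and \<open>\<phi>2\<close> are the induction hypotheses. These are needed
  at all related pairs, hence the generalisation over \<open>x\<close> and \<open>t\<close>.\<close>

lemma safe_L_simulation:
  fixes P :: "('s::finite, 'a::finite, 'z::finite, 'ap) pomdp"
    and M2 :: "('t::finite, 'a, 'z option, 'ap) wa"
  assumes "safe_L \<phi>" "is_pomdp P" "is_wa M2" "safe_simulation (corresponding_wa P) M2 R"
    and "(x, t) \<in> R" "pomdp_label P (split_state P x) = wa_label M2 t"
    and "pomdp_sat P \<phi> (split_state P x)"
  shows "wa_sat M2 \<phi> t"
  using assms(1,5-7)
proof (induction \<phi> arbitrary: x t rule: safe_L.induct)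
  case (5 \<phi>1 \<phi>2 p b k)
  then show ?case
    using PUntil_simulation[OF assms(2-4), of \<phi>1 \<phi>2 x t b p k]
    by (simp only: pomdp_sat.simps(5) wa_sat.simps(5)) blast
qed auto

lemma safe_S_simulation:
  fixes P :: "('s::finite, 'a::finite, 'z::finite, 'ap) pomdp"
    and M2 :: "('t::finite, 'a, 'z option, 'ap) wa"
  assumes "safe_S \<phi>" "is_pomdp P" "is_wa M2" "safe_simulation (corresponding_wa P) M2 R"
    and "(x, t) \<in> R" "pomdp_label P (split_state P x) = wa_label M2 t"
    and "wa_sat M2 \<phi> t"
  shows "pomdp_sat P \<phi> (split_state P x)"
  using assms(1,5-7)
\<comment> \<open>\<open>x\<close> and \<open>t\<close> stay fixed: \<open>And\<close> and
  \<open>Or\<close> keep the state, and the until case leaves all other states to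
  \<open>safe_L_simulation\<close>.\<close>
proof (induction \<phi> rule: safe_S.induct)
  case (5 \<phi>1 \<phi>2 p b k)
  then show ?case
    by (intro PUntil_simulation[OF assms(2-4)]) (auto intro: safe_L_simulation[OF _ assms(2-4)] simp del: wa_sat.simps)
qed auto

theorem theorem1:
  fixes P :: "('s::finite, 'a::finite, 'z::finite, 'ap) pomdp"
    and M1 :: "(('s \<times> 'z) option, 'a, 'z option, 'ap) wa"
    and M2 :: "('t::finite, 'a, 'z option, 'ap) wa"
    and \<phi> :: "'ap pctl"
  assumes "safe_S \<phi>"
    and "is_pomdp P"
    and "M1 = corresponding_wa P"
    and "is_wa M2"
    and "safely_simulated M1 M2"
    and init_labels: "wa_label M1 (wa_init M1) = wa_label M2 (wa_init M2)"
    and "wa_models M2 \<phi>"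
  shows "pomdp_models P \<phi>"
proof -
  have init: "wa_init M1 = None" "split_state P None = pomdp_init P"
    by (simp_all add: assms(3) corresponding_wa_def split_state_def)
  obtain R where R: "safe_simulation (corresponding_wa P) M2 R" "(None, wa_init M2) \<in> R"
    using assms(3,5) init by (auto simp: safely_simulated_def)
  \<comment> \<open>A safe simulation compares labels of successors only, so agreement at the start
    comes from \<open>init_labels\<close>.\<close>
  have "pomdp_label P (split_state P None) = wa_label M2 (wa_init M2)"
    using init_labels by (simp add: assms(3) corresponding_wa_def)
  then have "pomdp_sat P \<phi> (split_state P None)"
    using safe_S_simulation[OF assms(1,2,4) R] assms(7) by (simp add: wa_models_def)
  then show ?thesis by (simp add: pomdp_models_def init)
qed

end
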